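(* Every closed confluent IOSA is weakly deterministic.
   Context: An input/output stochastic automaton with urgency (IOSA) is a tuple $\mathcal I=(\mathcal S,\mathcal A,\mathcal C,\rightarrow,C_0,s_0)$ where: $\mathcal S$ is a denumerable set of states; $\mathcal A$ is a denumerable set of actions partitioned into disjoint sets of input actions $\mathcal A^{\mathsf i}$ and output actions $\mathcal A^{\mathsf o}$, with a subset $\mathcal A^{\mathsf u}\subseteq\mathcal A$ of urgent actions and a distinguished silent action $\tau\in\mathcal A^{\mathsf u}\cap\mathcal A^{\mathsf o}$; $\mathcal C=\{x_1,\dots,x_N\}$ is a finite set of clocks, each $x\in\mathcal C$ having a continuous probability measure $\mu_x$ on $\mathbb R$ with $\mu_x(\mathbb R_{>0})=1$; $\rightarrow\subseteq\mathcal S\times 2^{\mathcal C}\times\mathcal A\times 2^{\mathcal C}\times\mathcal S$ is the transition relation, written $s\xrightarrow{C,a,C'}s'$; $C_0\subseteq\mathcal C$; $s_0\in\mathcal S$ is the initial state. Writing $\_$ for an existentially quantified parameter, let $\mathrm{enabling}(s)=\{y\mid s\xrightarrow{\{y\},\_,\_}\_\}$, and call $s$ stable if there is no $a\in\mathcal A^{\mathsf u}\cap\mathcal A^{\mathsf o}$ with $s\xrightarrow{\emptyset,a,\_}\_$. It is required that: (a) if $s\xrightarrow{C,a,C'}s'$ and $a\in\mathcal A^{\mathsf i}\cup\mathcal A^{\mathsf u}$ then $C=\emptyset$; (b) if $s\xrightarrow{C,a,C'}s'$ and $a\in\mathcal A^{\mathsf o}\setminus\mathcal A^{\mathsf u}$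 then $C$ is a singleton; (c) if $s\xrightarrow{\{x\},a_1,C_1}s_1$ and $s\xrightarrow{\{x\},a_2,C_2}s_2$ then $a_1=a_2$, $C_1=C_2$, $s_1=s_2$; (d) for every $a\in\mathcal A^{\mathsf i}$ and state $s$ there is some $s\xrightarrow{\emptyset,a,C}s'$; (e) for $a\in\mathcal A^{\mathsf i}$, if $s\xrightarrow{\emptyset,a,C_1'}s_1$ and $s\xrightarrow{\emptyset,a,C_2'}s_2$ then $C_1'=C_2'$ and $s_1=s_2$; (f) there is $\mathrm{active}:\mathcal S\to 2^{\mathcal C}$ with $\mathrm{active}(s_0)\subseteq C_0$, $\mathrm{enabling}(s)\subseteq\mathrm{active}(s)$, $\mathrm{active}(s)=\mathrm{enabling}(s)$ if $s$ is stable, and $\mathrm{active}(s)\subseteq(\mathrm{active}(t)\setminus C)\cup C'$ whenever $t\xrightarrow{C,a,C'}s$. $\mathcal I$ is closed if $\mathcal A^{\mathsf i}=\emptyset$. $\mathcal I$ is confluent w.r.t. $a,b\in\mathcal A^{\mathsf u}$ if for every state $s$ and transitions $s\xrightarrow{\emptyset,a,C_1}s_1$, $s\xrightarrow{\emptyset,b,C_2}s_2$ there is $s_3$ with $s_1\xrightarrow{\emptyset,b,C_2}s_3$ and $s_2\xrightarrow{\emptyset,a,C_1}s_3$; $\mathcal I$ is confluent if it is confluent w.r.t. every pair of urgent actions. Semantics: $\mathcal P(\mathcal I)$ has state space $\mathbf S=(\mathcal S\cup\{\mathsf{init}\})\times\mathbb R^N$ with the Borel $\sigma$-algebra, labels $\mathcal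 L=\mathcal A\cup\mathbb R_{>0}\cup\{\mathsf{init}\}$, and for each label $\ell$ a map $\mathcal T_\ell$ from states to sets of probability measures on $\mathbf S$: $\mathcal T_{\mathsf{init}}(\mathsf{init},\vec v)=\{\delta_{s_0}\times\prod_{i=1}^N\mu_{x_i}\}$; for $a\in\mathcal A$, $\mathcal T_a(s,\vec v)=\{\mu^{\vec v}_{C',s'}\mid s\xrightarrow{C,a,C'}s',\ \vec v(i)\le 0\text{ for all }x_i\in C\}$ where $\mu^{\vec v}_{C',s'}=\delta_{s'}\times\prod_{i=1}^N\bar\mu_{x_i}$ with $\bar\mu_{x_i}=\mu_{x_i}$ if $x_i\in C'$ and $\bar\mu_{x_i}=\delta_{\vec v(i)}$ otherwise; for $d\in\mathbb R_{>0}$, $\mathcal T_d(s,\vec v)=\{\delta_s\times\prod_{i=1}^N\delta_{\vec v(i)-d}\}$ if there is no $b\in\mathcal A^{\mathsf u}\cap\mathcal A^{\mathsf o}$ with $s\xrightarrow{\_,b,\_}\_$ and $0<d\le\min\{\vec v(i)\mid\exists a\in\mathcal A^{\mathsf o},C',s': s\xrightarrow{\{x_i\},a,C'}s'\}$, and $\emptyset$ otherwise; all other combinations give $\emptyset$. Write $(s,\vec v)\xrightarrow{\ell}\mu$ for $\mu\in\mathcal T_\ell(s,\vec v)$. Weak transitions: for a closed IOSA in which all urgent actions have been renamed to $\tau$, for non-stable $s$ and $\vec v\in\mathbb R^N$, define $(s,\vec v)\Rightarrow^{C}_n\mu$ inductively: (T1) if $s\xrightarrow{\emptyset,\tau,C}s'$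 with $s'$ stable, then $(s,\vec v)\Rightarrow^C_1\mu^{\vec v}_{C,s'}$; (T2) if $s\xrightarrow{\emptyset,\tau,C'}s'$ and for every $\vec v'\in\mathbb R^N$ there are $C'',\mu'$ with $(s',\vec v')\Rightarrow^{C''}_n\mu'$, then $(s,\vec v)\Rightarrow^{C'\cup C''}_{n+1}\int_{\mathcal S\times\mathbb R^N}f^{C''}_n\,d\mu^{\vec v}_{C',s'}$, where $f^{C''}_n(t,\vec w)=\nu$ if $(t,\vec w)\Rightarrow^{C''}_n\nu$ and $f^{C''}_n(t,\vec w)$ is the null measure otherwise. $(s,\vec v)\Rightarrow\mu$ means $(s,\vec v)\Rightarrow^C_n\mu$ for some $n\ge1$, $C\subseteq\mathcal C$. Weak determinism: a closed IOSA (with urgent actions renamed to $\tau$) is weakly deterministic if $\Rightarrow$ is well defined (in particular all $f^C_n$ are measurable) and, in $\mathcal P(\mathcal I)$, the states $(s,\vec v)$ satisfying any of the following are almost never reached from any $(\mathsf{init},\vec v_0)$: (a) $s$ is stable and $\bigcup_{a\in\mathcal A\cup\{\mathsf{init}\}}\mathcal T_a(s,\vec v)$ contains at least two different measures; (b) $s$ is not stable, $(s,\vec v)\Rightarrow\mu$, $(s,\vec v)\Rightarrow\mu'$ and $\mu\ne\mu'$; (c) $s$ is not stable and $(s,\vec v)\xrightarrow{a}\mu$ for some $a\in\mathcal A^{\mathsf o}\setminus\mathcal A^{\mathsf u}$. "Almost never reached" means that, under any scheduler of the NLMP, the probability measure on paths assigns measure zero to the set of paths leading to any measurable subset of $\mathbf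 S$ containing only such states. *)

theory Defs
  imports "HOL-Probability.Probability"
begin

section \<open>Input/output stochastic automata with urgency\<close>

record ('s, 'a, 'c) iosa =
  states :: "'s set"
  inputs :: "'a set"
  outputs :: "'a set"
  urgent :: "'a set"
  silent :: 'a
  clocks :: "'c set"
  clock_dist :: "'c \<Rightarrow> real measure"
  step :: "'s \<Rightarrow> 'c set \<Rightarrow> 'a \<Rightarrow> 'c set \<Rightarrow> 's \<Rightarrow> bool"
  start_clocks :: "'c set"
  start :: 's

definition enabling :: "('s, 'a, 'c) iosa \<Rightarrow> 's \<Rightarrow> 'c set" where
  "enabling I s = {y. \<exists>a C' s'. step I s {y} a C' s'}"

definition is_stable :: "('s, 'a, 'c) iosa \<Rightarrow> 's \<Rightarrow> bool" where
  "is_stable I s \<longleftrightarrow> \<not> (\<exists>a\<in>urgent I \<inter> outputs I. \<exists>C' s'. step I s {} a C' s')"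

text \<open>
  A continuous measure is one without atoms; in particular this covers every measure that has a
  density.
\<close>

locale IOSA =
  fixes I :: "('s, 'a, 'c) iosa"
  assumes countable_states: "countable (states I)"
    and countable_actions: "countable (inputs I \<union> outputs I)"
    and disjoint_actions: "inputs I \<inter> outputs I = {}"
    and urgent_actions: "urgent I \<subseteq> inputs I \<union> outputs I"
    and silent_action: "silent I \<in> urgent I \<inter> outputs I"
    and finite_clocks: "finite (clocks I)"
    and sets_clock_dist: "x \<in> clocks I \<Longrightarrow> sets (clock_dist I x) = sets borel"
    and prob_space_clock_dist: "x \<in> clocks I \<Longrightarrow> prob_space (clock_dist I x)"
    and continuous_clock_dist: "x \<in> clocks I \<Longrightarrow> emeasure (clock_dist I x) {r} = 0"
    and positive_clock_dist: "x \<in> clocks I \<Longrightarrow> emeasure (clock_dist I x) {0<..} = 1"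
    and step_carrier: "step I s C a C' s' \<Longrightarrow>
      s \<in> states I \<and> C \<subseteq> clocks I \<and> a \<in> inputs I \<union> outputs I \<and> C' \<subseteq> clocks I \<and> s' \<in> states I"
    and start_clocks: "start_clocks I \<subseteq> clocks I"
    and start: "start I \<in> states I"
    and step_reactive: "step I s C a C' s' \<Longrightarrow> a \<in> inputs I \<union> urgent I \<Longrightarrow> C = {}"
    and step_generative: "step I s C a C' s' \<Longrightarrow> a \<in> outputs I - urgent I \<Longrightarrow> \<exists>x. C = {x}"
    and clock_deterministic: "step I s {x} a1 C1 s1 \<Longrightarrow> step I s {x} a2 C2 s2 \<Longrightarrow>
      a1 = a2 \<and> C1 = C2 \<and> s1 = s2"
    and input_enabled: "a \<in> inputs I \<Longrightarrow> s \<in> states I \<Longrightarrow> \<exists>C s'. step I s {} a C s'"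
    and input_deterministic: "a \<in> inputs I \<Longrightarrow> step I s {} a C1 s1 \<Longrightarrow> step I s {} a C2 s2 \<Longrightarrow>
      C1 = C2 \<and> s1 = s2"
    and active_clocks: "\<exists>active :: 's \<Rightarrow> 'c set.
      (\<forall>s\<in>states I. active s \<subseteq> clocks I) \<and>
      active (start I) \<subseteq> start_clocks I \<and>
      (\<forall>s\<in>states I. enabling I s \<subseteq> active s) \<and>
      (\<forall>s\<in>states I. is_stable I s \<longrightarrow> active s = enabling I s) \<and>
      (\<forall>t C a C' s. step I t C a C' s \<longrightarrow> active s \<subseteq> (active t - C) \<union> C')"

definition closed_iosa :: "('s, 'a, 'c) iosa \<Rightarrow> bool" where
  "closed_iosa I \<longleftrightarrow> inputs I = {}"

text \<open>
  The diamond is required for two different transitions, where \<open>a = b\<close> is allowed. If a transition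
  also had to be completed against itself, then every urgent transition
  \<open>s \<rightarrow> s1\<close> would have to be followed by the same transition out of \<open>s1\<close>, so that urgent output
  transitions could never lead to a stable state. The lemma \<open>confluent_wrtI\<close> shows that the
  condition without the inequality implies the present one.
\<close>

definition confluent_wrt :: "('s, 'a, 'c) iosa \<Rightarrow> 'a \<Rightarrow> 'a \<Rightarrow> bool" where
  "confluent_wrt I a b \<longleftrightarrow>
    (\<forall>s C1 s1 C2 s2. step I s {} a C1 s1 \<longrightarrow> step I s {} b C2 s2 \<longrightarrow> (a, C1, s1) \<noteq> (b, C2, s2) \<longrightarrow>
      (\<exists>s3. step I s1 {} b C2 s3 \<and> step I s2 {} a C1 s3))"

lemma confluent_wrtI:
  assumes "\<And>s C1 s1 C2 s2. step I s {} a C1 s1 \<Longrightarrow> step I s {} b C2 s2 \<Longrightarrow>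
    \<exists>s3. step I s1 {} b C2 s3 \<and> step I s2 {} a C1 s3"
  shows "confluent_wrt I a b"
  using assms unfolding confluent_wrt_def by blast

definition confluent :: "('s, 'a, 'c) iosa \<Rightarrow> bool" where
  "confluent I \<longleftrightarrow> (\<forall>a\<in>urgent I. \<forall>b\<in>urgent I. confluent_wrt I a b)"

definition rename_urgent :: "('s, 'a, 'c) iosa \<Rightarrow> ('s, 'a, 'c) iosa" where
  "rename_urgent I = I
    \<lparr> inputs := inputs I - urgent I,
      outputs := insert (silent I) (outputs I - urgent I),
      urgent := {silent I},
      step := \<lambda>s C b C' s'. \<exists>a. step I s C a C' s' \<and> b = (if a \<in> urgent I then silent I else a) \<rparr>"


section \<open>The labelled Markov process of an automaton\<close>

text \<open>
  A state is a pair of a location and a clock valuation. The location \<open>None\<close> stands for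
  \<open>init\<close>. Valuations are the elements of a finite product of copies of the reals, hence extensional
  functions on \<open>clocks I\<close>.
\<close>

type_synonym ('s, 'c) nlmp_state = "'s option \<times> ('c \<Rightarrow> real)"

datatype 'a label = Act 'a | Delay real | Init

definition locations :: "('s, 'a, 'c) iosa \<Rightarrow> 's option set" where
  "locations I = insert None (Some ` states I)"

definition valuations :: "('s, 'a, 'c) iosa \<Rightarrow> ('c \<Rightarrow> real) measure" where
  "valuations I = PiM (clocks I) (\<lambda>_. borel)"

definition state_space :: "('s, 'a, 'c) iosa \<Rightarrow> ('s, 'c) nlmp_state measure" where
  "state_space I = count_space (locations I) \<Otimes>\<^sub>M valuations I"

text \<open>The measure written \<open>\<mu>\<^sup>v\<close> with index \<open>(C', s')\<close>: resample the clocks in \<open>C'\<close>, keep the others.\<close>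

definition jump :: "('s, 'a, 'c) iosa \<Rightarrow> ('c \<Rightarrow> real) \<Rightarrow> 'c set \<Rightarrow> 's \<Rightarrow> ('s, 'c) nlmp_state measure"
  where
  "jump I v C' s' = return (count_space (locations I)) (Some s') \<Otimes>\<^sub>M
     PiM (clocks I) (\<lambda>x. if x \<in> C' then clock_dist I x else return borel (v x))"

text \<open>
  The infimum is taken in the extended reals, so that a state which enables no clock
  lets any amount of time pass.
\<close>

fun nlmp :: "('s, 'a, 'c) iosa \<Rightarrow> 'a label \<Rightarrow> ('s, 'c) nlmp_state \<Rightarrow> ('s, 'c) nlmp_state measure set"
  where
  "nlmp I Init (None, v) = {jump I v (clocks I) (start I)}"
| "nlmp I (Act a) (Some s, v) =
    {jump I v C' s' | C C' s'. step I s C a C' s' \<and> (\<forall>x\<in>C. v x \<le> 0)}"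
| "nlmp I (Delay d) (Some s, v) =
    (if \<not> (\<exists>b\<in>urgent I \<inter> outputs I. \<exists>C C' s'. step I s C b C' s') \<and> 0 < d \<and>
        ereal d \<le> (INF x \<in> {x. \<exists>a\<in>outputs I. \<exists>C' s'. step I s {x} a C' s'}. ereal (v x))
     then {jump I (\<lambda>x. v x - d) {} s} else {})"
| "nlmp I _ _ = {}"


section \<open>Schedulers and paths\<close>

definition label_space :: "('s, 'a, 'c) iosa \<Rightarrow> 'a label measure" where
  "label_space I =
    sigma (Act ` (inputs I \<union> outputs I) \<union> Delay ` {0<..} \<union> {Init})
      ({Act ` A | A. A \<subseteq> inputs I \<union> outputs I} \<union>
       {Delay ` D | D. D \<in> sets borel \<and> D \<subseteq> {0<..}} \<union> {{Init}})"

text \<open>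
  A path from the state \<open>z0\<close> is a sequence \<open>\<omega>\<close> of labels and states, where \<open>\<omega> n\<close> is the label of
  the \<open>(n+1)\<close>-st transition together with the state it leads to; \<open>z0\<close> itself is not part of the
  sequence. Finite histories with \<open>n\<close> transitions are indexed by \<open>{0..<n}\<close>.
\<close>

definition move_space :: "('s, 'a, 'c) iosa \<Rightarrow> ('a label \<times> ('s, 'c) nlmp_state) measure" where
  "move_space I = label_space I \<Otimes>\<^sub>M state_space I"

definition current ::
  "('s, 'c) nlmp_state \<Rightarrow> nat \<Rightarrow> (nat \<Rightarrow> 'a label \<times> ('s, 'c) nlmp_state) \<Rightarrow> ('s, 'c) nlmp_state"
  where
  "current z0 n \<omega> = (case n of 0 \<Rightarrow> z0 | Suc m \<Rightarrow> snd (\<omega> m))"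

type_synonym ('s, 'a, 'c) scheduler =
  "nat \<Rightarrow> (nat \<Rightarrow> 'a label \<times> ('s, 'c) nlmp_state) \<Rightarrow> ('a label \<times> ('s, 'c) nlmp_state measure) measure"

text \<open>
  Schedulers are history dependent and randomised: after each history they choose, with
  probability one, a transition that is possible in the current state. They need not be able to
  stop, since a closed automaton has no deadlocks (see \<open>closed_iosa_no_deadlock\<close>).
\<close>

definition is_scheduler ::
  "('s, 'a, 'c) iosa \<Rightarrow> ('s, 'c) nlmp_state \<Rightarrow> ('s, 'a, 'c) scheduler \<Rightarrow> bool" where
  "is_scheduler I z0 \<sigma> \<longleftrightarrow>
    (\<forall>n. \<sigma> n \<in> PiM {0..<n} (\<lambda>_. move_space I) \<rightarrow>\<^sub>M
           prob_algebra (label_space I \<Otimes>\<^sub>M prob_algebra (state_space I)) \<and>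
      (\<forall>h\<in>space (PiM {0..<n} (\<lambda>_. move_space I)).
         AE (l, \<mu>) in \<sigma> n h. \<mu> \<in> nlmp I l (current z0 n h)))"

definition move_kernel ::
  "('s, 'a, 'c) iosa \<Rightarrow> ('s, 'a, 'c) scheduler \<Rightarrow> nat \<Rightarrow>
     (nat \<Rightarrow> 'a label \<times> ('s, 'c) nlmp_state) \<Rightarrow> ('a label \<times> ('s, 'c) nlmp_state) measure" where
  "move_kernel I \<sigma> n h = \<sigma> n h \<bind> (\<lambda>(l, \<mu>). distr \<mu> (move_space I) (\<lambda>z. (l, z)))"

text \<open>The measure on infinite paths given by the Ionescu-Tulcea theorem.\<close>

definition path_measure ::
  "('s, 'a, 'c) iosa \<Rightarrow> ('s, 'a, 'c) scheduler \<Rightarrow> (nat \<Rightarrow> 'a label \<times> ('s, 'c) nlmp_state) measure"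
  where
  "path_measure I \<sigma> =
    projective_family.lim UNIV (Ionescu_Tulcea.CI (move_kernel I \<sigma>) (\<lambda>_. move_space I))
      (\<lambda>_. move_space I)"

definition almost_never_reached ::
  "('s, 'a, 'c) iosa \<Rightarrow> ('s, 'c) nlmp_state set \<Rightarrow> bool" where
  "almost_never_reached I Z \<longleftrightarrow>
    (\<forall>v0\<in>space (valuations I). \<forall>\<sigma>. is_scheduler I (None, v0) \<sigma> \<longrightarrow>
      (\<forall>B\<in>sets (state_space I). B \<subseteq> Z \<longrightarrow>
        emeasure (path_measure I \<sigma>)
          {\<omega> \<in> space (path_measure I \<sigma>). \<exists>n. current (None, v0) n \<omega> \<in> B} = 0))"


section \<open>Weak transitions and weak determinism\<close>

text \<open>
  The function \<open>f\<close> of a relation \<open>W\<close> between states and measures. The description is meaningful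
  only if \<open>W\<close> is single valued, which is part of \<open>weak_well_defined\<close> below.
\<close>

definition weak_fun ::
  "('s, 'a, 'c) iosa \<Rightarrow> (('s, 'c) nlmp_state \<Rightarrow> ('s, 'c) nlmp_state measure \<Rightarrow> bool) \<Rightarrow>
    ('s, 'c) nlmp_state \<Rightarrow> ('s, 'c) nlmp_state measure" where
  "weak_fun I W z = (if \<exists>\<nu>. W z \<nu> then (THE \<nu>. W z \<nu>) else null_measure (state_space I))"

text \<open>
  \<open>weak_n I n C z \<mu>\<close> is the \<open>n\<close>-step weak transition that resamples the clocks \<open>C\<close>, with one
  disjunct for each of the two rules. It refers to the action \<open>silent I\<close> only and is meant for
  automata without other urgent actions. Whether
  \<open>weak_n I n C (Some s, v) \<mu>\<close> holds for some \<open>\<mu>\<close> does not depend on \<open>v\<close>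
  (\<open>weak_n_enabled_indep\<close>), so it makes no difference whether \<open>C''\<close> is
  chosen before or after the valuation \<open>v'\<close>. The integral of \<open>f\<close> is the Giry bind; \<open>f\<close> is null
  at the location \<open>init\<close>.
\<close>

primrec weak_n ::
  "('s, 'a, 'c) iosa \<Rightarrow> nat \<Rightarrow> 'c set \<Rightarrow> ('s, 'c) nlmp_state \<Rightarrow> ('s, 'c) nlmp_state measure \<Rightarrow> bool"
  where
  "weak_n I 0 = (\<lambda>C z \<mu>. False)"
| "weak_n I (Suc n) = (\<lambda>C z \<mu>. \<exists>s v. z = (Some s, v) \<and>
    ((n = 0 \<and> (\<exists>s'. step I s {} (silent I) C s' \<and> is_stable I s' \<and> \<mu> = jump I v C s')) \<or>
     (n \<ge> 1 \<and> (\<exists>C' C'' s'. step I s {} (silent I) C' s' \<and> C = C' \<union> C'' \<and>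
        (\<forall>v'\<in>space (valuations I). \<exists>\<mu>'. weak_n I n C'' (Some s', v') \<mu>') \<and>
        \<mu> = jump I v C' s' \<bind> weak_fun I (weak_n I n C'')))))"

definition weak ::
  "('s, 'a, 'c) iosa \<Rightarrow> ('s, 'c) nlmp_state \<Rightarrow> ('s, 'c) nlmp_state measure \<Rightarrow> bool" where
  "weak I z \<mu> \<longleftrightarrow> (\<exists>n\<ge>1. \<exists>C\<subseteq>clocks I. weak_n I n C z \<mu>)"

definition weak_well_defined :: "('s, 'a, 'c) iosa \<Rightarrow> bool" where
  "weak_well_defined I \<longleftrightarrow> (\<forall>n\<ge>1. \<forall>C\<subseteq>clocks I.
     (\<forall>z\<in>space (state_space I). \<forall>\<nu> \<nu>'. weak_n I n C z \<nu> \<longrightarrow> weak_n I n C z \<nu>' \<longrightarrow> \<nu> = \<nu>') \<and>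
     weak_fun I (weak_n I n C) \<in> state_space I \<rightarrow>\<^sub>M subprob_algebra (state_space I))"

text \<open>The location \<open>init\<close> counts as stable, as it has no outgoing action.\<close>

definition stable_location :: "('s, 'a, 'c) iosa \<Rightarrow> 's option \<Rightarrow> bool" where
  "stable_location I q \<longleftrightarrow> (case q of None \<Rightarrow> True | Some s \<Rightarrow> is_stable I s)"

definition nondeterministic_state :: "('s, 'a, 'c) iosa \<Rightarrow> ('s, 'c) nlmp_state \<Rightarrow> bool" where
  "nondeterministic_state I z \<longleftrightarrow>
    (stable_location I (fst z) \<and>
      (\<exists>\<mu> \<mu>'. \<mu> \<noteq> \<mu>' \<and> {\<mu>, \<mu>'} \<subseteq> (\<Union>l \<in> insert Init (Act ` (inputs I \<union> outputs I)). nlmp I l z))) \<or>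
    (\<not> stable_location I (fst z) \<and> (\<exists>\<mu> \<mu>'. weak I z \<mu> \<and> weak I z \<mu>' \<and> \<mu> \<noteq> \<mu>')) \<or>
    (\<not> stable_location I (fst z) \<and> (\<exists>a\<in>outputs I - urgent I. \<exists>\<mu>. \<mu> \<in> nlmp I (Act a) z))"

definition weakly_deterministic :: "('s, 'a, 'c) iosa \<Rightarrow> bool" where
  "weakly_deterministic I \<longleftrightarrow>
    weak_well_defined (rename_urgent I) \<and>
    almost_never_reached (rename_urgent I)
      {z \<in> space (state_space (rename_urgent I)). nondeterministic_state (rename_urgent I) z}"


section \<open>Basic facts about the definitions\<close>

lemma weak_n_enabled_indep:
  assumes "weak_n I n C (Some s, v) \<mu>"
  shows "\<exists>\<mu>'. weak_n I n C (Some s, v') \<mu>'"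
  using assms by (cases n) (simp_all, blast)

lemma IOSA_rename_urgent:
  assumes "IOSA I" "closed_iosa I"
  shows "IOSA (rename_urgent I)"
proof -
  interpret IOSA I by fact
  have no_inputs: "inputs I = {}"
    using assms(2) by (simp add: closed_iosa_def)
  have en: "enabling (rename_urgent I) = enabling I"
    by (auto simp: enabling_def rename_urgent_def fun_eq_iff)
  have st: "is_stable (rename_urgent I) = is_stable I"
    using silent_action urgent_actions no_inputs
    by (fastforce simp: is_stable_def rename_urgent_def fun_eq_iff)
  obtain active where active:
    "\<And>s. s \<in> states I \<Longrightarrow> active s \<subseteq> clocks I" "active (start I) \<subseteq> start_clocks I"
    "\<And>s. s \<in> states I \<Longrightarrow> enabling I s \<subseteq> active s"
    "\<And>s. s \<in> states I \<Longrightarrow> is_stable I s \<Longrightarrow> active s = enabling I s"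
    "\<And>t C a C' s. step I t C a C' s \<Longrightarrow> active s \<subseteq> (active t - C) \<union> C'"
    using active_clocks by metis
  have sel [simp]: "states (rename_urgent I) = states I" "inputs (rename_urgent I) = {}"
    "outputs (rename_urgent I) = insert (silent I) (outputs I - urgent I)"
    "urgent (rename_urgent I) = {silent I}" "silent (rename_urgent I) = silent I"
    "clocks (rename_urgent I) = clocks I" "clock_dist (rename_urgent I) = clock_dist I"
    "start_clocks (rename_urgent I) = start_clocks I" "start (rename_urgent I) = start I"
    "\<And>s C b C' s'. step (rename_urgent I) s C b C' s' \<longleftrightarrow>
       (\<exists>a. step I s C a C' s' \<and> b = (if a \<in> urgent I then silent I else a))"
    by (auto simp: rename_urgent_def no_inputs)
  show ?thesis
  proof (rule IOSA.intro, goal_cases)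
    case 1 show ?case using countable_states by simp
  next
    case 2 show ?case using countable_actions by simp
  next
    case 3 show ?case by simp
  next
    case 4 show ?case by simp
  next
    case 5 show ?case by simp
  next
    case 6 show ?case using finite_clocks by simp
  next
    case 7 then show ?case using sets_clock_dist by simp
  next
    case 8 then show ?case using prob_space_clock_dist by simp
  next
    case 9 then show ?case using continuous_clock_dist by simp
  next
    case 10 then show ?case using positive_clock_dist by simp
  next
    case (11 s C b C' s')
    then obtain a where a: "step I s C a C' s'" "b = (if a \<in> urgent I then silent I else a)"
      unfolding sel by blast
    show ?case
      using step_carrier[OF a(1)] a(2) by (simp add: no_inputs)
  next
    case 12 show ?case using start_clocks by simp
  next
    case 13 show ?case using start by simp
  next
    case (14 s C b C' s')
    then obtain a where a: "step I s C a C' s'" "b = (if a \<in> urgent I then silent I else a)"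
      unfolding sel by blast
    then have "a \<in> urgent I"
      using 14(2) silent_action by (simp split: if_splits)
    then show ?case
      using step_reactive[OF a(1)] by simp
  next
    case (15 s C b C' s')
    then obtain a where a: "step I s C a C' s'" "b = (if a \<in> urgent I then silent I else a)"
      unfolding sel by blast
    then have "a \<in> outputs I - urgent I"
      using 15(2) by (simp split: if_splits)
    then show ?case
      using step_generative[OF a(1)] by simp
  next
    case (16 s x b1 C1 s1 b2 C2 s2)
    then obtain a1 a2 where "step I s {x} a1 C1 s1" "b1 = (if a1 \<in> urgent I then silent I else a1)"
      "step I s {x} a2 C2 s2" "b2 = (if a2 \<in> urgent I then silent I else a2)"
      unfolding sel by blast
    then show ?case
      using clock_deterministic[of s x a1 C1 s1 a2 C2 s2] by simp
  next
    case 17 then show ?case by simp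
  next
    case 18 then show ?case by simp
  next
    case 19 show ?case
      unfolding en st
    proof (intro exI[of _ active] conjI allI impI ballI)
      fix t C b C' s assume "step (rename_urgent I) t C b C' s"
      then obtain a where "step I t C a C' s"
        unfolding sel by blast
      then show "active s \<subseteq> (active t - C) \<union> C'"
        by (rule active(5))
    qed (simp_all add: active)
  qed
qed

lemma closed_iosa_no_deadlock:
  assumes "IOSA I" "closed_iosa I" "z \<in> space (state_space I)"
  shows "\<exists>l \<mu>. \<mu> \<in> nlmp I l z"
proof -
  interpret IOSA I by fact
  have no_inputs: "inputs I = {}"
    using assms(2) by (simp add: closed_iosa_def)
  obtain q v where z: "z = (q, v)" by force
  show ?thesis
  proof (cases q)
    case None
    then show ?thesis
      using z nlmp.simps(1)[of I v] by blast
  next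
    case (Some s)
    show ?thesis
    proof (cases "\<exists>C a C' s'. step I s C a C' s' \<and> (\<forall>x\<in>C. v x \<le> 0)")
      case True
      then obtain C a C' s' where "step I s C a C' s'" "\<forall>x\<in>C. v x \<le> 0" by blast
      then have "jump I v C' s' \<in> nlmp I (Act a) z"
        using z Some by auto
      then show ?thesis by blast
    next
      case False
      define X where "X = {x. \<exists>a\<in>outputs I. \<exists>C' s'. step I s {x} a C' s'}"
      have "X \<subseteq> clocks I" using step_carrier by (fastforce simp: X_def)
      then have fin: "finite X" using finite_clocks finite_subset by blast
      have pos: "v x > 0" if "x \<in> X" for x
        using that False by (force simp: X_def)
      define d where "d = Min (insert 1 (v ` X))"
      have d: "d > 0" "\<And>x. x \<in> X \<Longrightarrow> d \<le> v x"
        using fin pos by (auto simp: d_def)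
      have urg: "\<not> (\<exists>b\<in>urgent I \<inter> outputs I. \<exists>C C' s'. step I s C b C' s')"
        using False step_reactive by blast
      have le: "ereal d \<le> (INF x\<in>X. ereal (v x))"
        using d by (auto intro: INF_greatest)
      have "jump I (\<lambda>x. v x - d) {} s \<in> nlmp I (Delay d) z"
        using urg d(1) le z Some unfolding X_def by simp
      then show ?thesis by blast
    qed
  qed
qed

lemma Ionescu_Tulcea_move_kernel:
  assumes "is_scheduler I z0 \<sigma>"
  shows "Ionescu_Tulcea (move_kernel I \<sigma>) (\<lambda>_. move_space I)"
proof (rule Ionescu_Tulcea.intro)
  fix n
  have \<sigma>: "\<sigma> n \<in> PiM {0..<n} (\<lambda>_. move_space I) \<rightarrow>\<^sub>M
      prob_algebra (label_space I \<Otimes>\<^sub>M prob_algebra (state_space I))"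
    using assms by (simp add: is_scheduler_def)
  have K: "(\<lambda>(l, \<mu>). distr \<mu> (move_space I) (\<lambda>z. (l, z))) \<in>
      label_space I \<Otimes>\<^sub>M prob_algebra (state_space I) \<rightarrow>\<^sub>M prob_algebra (move_space I)"
    unfolding move_space_def split_beta'
    by (rule measurable_distr_prob_space2[where M = "state_space I"]) measurable
  have bind: "move_kernel I \<sigma> n \<in> PiM {0..<n} (\<lambda>_. move_space I) \<rightarrow>\<^sub>M prob_algebra (move_space I)"
    unfolding move_kernel_def
    by (rule measurable_bind_prob_space[OF \<sigma> K])
  then show "move_kernel I \<sigma> n \<in> PiM {0..<n} (\<lambda>_. move_space I) \<rightarrow>\<^sub>M subprob_algebra (move_space I)"
    by (rule measurable_prob_algebraD)
  fix h assume "h \<in> space (PiM {0..<n} (\<lambda>_. move_space I))"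
  then show "prob_space (move_kernel I \<sigma> n h)"
    using measurable_space[OF bind] by (auto simp: space_prob_algebra)
qed

end

theory Submission
  imports Defs
begin

text \<open>
  Confluence makes all urgent runs from a state to a stable state agree in length, endpoint and set
  of resampled clocks, by permuting transitions; a weak transition is then a single jump to that
  endpoint. The remaining nondeterminism is excluded by an almost sure invariant: active clocks are
  pairwise distinct and nonnegative, and positive in non-stable states. Resampling preserves
  distinctness since clock distributions have no atoms. In a stable state every active clock is
  enabled, so a delay stops before an active clock becomes negative. The only clock that may have
  expired is consumed by the next action, hence all active clocks are positive after it and remain
  so during urgent transitions.
\<close>

section \<open>Invariants of paths\<close>

text \<open>A scheduler picks possible transitions almost surely, so one-step closure of
  \<open>G\<close> carries over to histories of every length by induction. Leaving \<open>G\<close>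
  is then a countable union of null events, one for each length.\<close>

lemma almost_never_reachedI:
  fixes I :: "('s, 'a, 'c) iosa"
  assumes G [measurable]: "G \<in> sets (state_space I)"
    and init: "\<And>v. v \<in> space (valuations I) \<Longrightarrow> (None, v) \<in> G"
    and closed: "\<And>z l \<mu>. z \<in> G \<Longrightarrow> \<mu> \<in> nlmp I l z \<Longrightarrow> AE z' in \<mu>. z' \<in> G"
    and disjoint: "Z \<inter> G = {}"
  shows "almost_never_reached I Z"
  unfolding almost_never_reached_def
proof (intro ballI allI impI)
  fix v0 \<sigma> B
  assume v0: "v0 \<in> space (valuations I)" and \<sigma>: "is_scheduler I (None, v0) \<sigma>"
    and B: "B \<in> sets (state_space I)" "B \<subseteq> Z"
  let ?cur = "current (None, v0)" and ?M = "\<lambda>_::nat. move_space I" and ?P = "move_kernel I \<sigma>"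
  \<comment> \<open>The empty history: the only point of a product over
    \<open>{0..<0}\<close>.\<close>
  let ?u = "\<lambda>_::nat. undefined"
  have space_init: "(None, v0) \<in> space (state_space I)"
    using init[OF v0] sets.sets_into_space[OF G] by blast
  interpret IT: Ionescu_Tulcea ?P ?M
    using \<sigma> by (rule Ionescu_Tulcea_move_kernel)
  have snd_meas [measurable]: "snd \<in> move_space I \<rightarrow>\<^sub>M state_space I"
    unfolding move_space_def by measurable
  have current_meas [measurable]: "?cur n \<in> PiM {0..<n} ?M \<rightarrow>\<^sub>M state_space I" for n
  proof (cases n)
    case (Suc m)
    have "(\<lambda>\<omega>. snd (\<omega> m)) \<in> PiM {0..<n} ?M \<rightarrow>\<^sub>M state_space I"
      by (rule measurable_compose[OF _ snd_meas], rule measurable_component_singleton)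
        (simp add: Suc)
    then show ?thesis
      by (simp add: current_def[abs_def] Suc)
  qed (simp add: current_def[abs_def] space_init)
  have meas_G [measurable]: "Measurable.pred (PiM {0..<n} ?M) (\<lambda>\<omega>. ?cur n \<omega> \<in> G)" for n
    by measurable
  \<comment> \<open>The kernel first draws a pair of label and measure and then a target state, so
    the claim splits into two nested almost sure statements. The outer one is the scheduler
    condition, the inner one is \<open>closed\<close>.\<close>
  have move: "AE m in ?P n h. snd m \<in> G"
    if h: "h \<in> space (PiM {0..<n} ?M)" and cur: "?cur n h \<in> G" for n h
  proof -
    have \<sigma>n: "\<sigma> n \<in> PiM {0..<n} ?M \<rightarrow>\<^sub>M prob_algebra (label_space I \<Otimes>\<^sub>M prob_algebra (state_space I))"
      and en: "AE (l, \<mu>) in \<sigma> n h. \<mu> \<in> nlmp I l (?cur n h)"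
      using \<sigma> h unfolding is_scheduler_def by auto
    have sets_\<sigma>: "sets (\<sigma> n h) = sets (label_space I \<Otimes>\<^sub>M prob_algebra (state_space I))"
      using measurable_space[OF \<sigma>n h] by (simp add: space_prob_algebra)
    have K: "(\<lambda>(l, \<mu>). distr \<mu> (move_space I) (\<lambda>z. (l, z))) \<in>
        \<sigma> n h \<rightarrow>\<^sub>M subprob_algebra (move_space I)"
      unfolding measurable_cong_sets[OF sets_\<sigma> refl] move_space_def split_beta'
      by (rule measurable_prob_algebraD,
          rule measurable_distr_prob_space2[where M = "state_space I"]) measurable
    have P: "Measurable.pred (move_space I) (\<lambda>m. snd m \<in> G)"
      by measurable
    have "AE x in \<sigma> n h. x \<in> space (label_space I \<Otimes>\<^sub>M prob_algebra (state_space I))"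
      using sets_eq_imp_space_eq[OF sets_\<sigma>] AE_space[of "\<sigma> n h"] by simp
    with en have "AE x in \<sigma> n h. AE m in (case x of (l, \<mu>) \<Rightarrow> distr \<mu> (move_space I) (\<lambda>z. (l, z))).
        snd m \<in> G"
    proof eventually_elim
      case (elim x)
      obtain l \<mu> where x: "x = (l, \<mu>)" by force
      have l: "l \<in> space (label_space I)" and \<mu>: "sets \<mu> = sets (state_space I)"
        using elim(2) by (auto simp: x space_pair_measure space_prob_algebra)
      have "(\<lambda>z. (l, z)) \<in> state_space I \<rightarrow>\<^sub>M move_space I"
        unfolding move_space_def by (rule measurable_Pair1'[OF l])
      then have "(\<lambda>z. (l, z)) \<in> \<mu> \<rightarrow>\<^sub>M move_space I"
        unfolding measurable_cong_sets[OF \<mu> refl] .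
      from AE_distr_iff[OF this predE[OF P]] closed[OF cur, of \<mu> l] elim(1)
      show ?case by (simp only: x prod.case snd_conv)
    qed
    then show ?thesis
      unfolding move_kernel_def AE_bind[OF K P] .
  qed
  \<comment> \<open>\<open>IT.C 0 n ?u\<close> is the distribution of the histories with
    \<open>n\<close> transitions.\<close>
  have AE_C: "AE h in IT.C 0 n ?u. ?cur n h \<in> G" for n
  proof (induction n)
    case 0
    show ?case using init[OF v0] by (simp add: current_def)
  next
    case (Suc n)
    have u: "?u \<in> space (PiM {0..<0} ?M)"
      by (simp add: space_PiM)
    have sets_C: "sets (IT.C 0 n ?u) = sets (PiM {0..<n} ?M)"
      using IT.sets_C[OF u, of n] by simp
    have eP: "IT.eP n \<in> IT.C 0 n ?u \<rightarrow>\<^sub>M subprob_algebra (PiM {0..<Suc n} ?M)"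
      unfolding measurable_cong_sets[OF sets_C refl] by (rule IT.measurable_eP)
    have "AE h in IT.C 0 n ?u. h \<in> space (PiM {0..<n} ?M)"
      using AE_space[of "IT.C 0 n ?u"] sets_eq_imp_space_eq[OF sets_C] by simp
    with Suc.IH have "AE h in IT.C 0 n ?u. AE y in IT.eP n h. ?cur (Suc n) y \<in> G"
    proof eventually_elim
      case (elim h)
      \<comment> \<open>\<open>IT.eP n h\<close> is the image of \<open>?P n h\<close> under writing
        the new move at index \<open>n\<close> of \<open>h\<close>; that move holds the state
        inspected by \<open>?cur (Suc n)\<close>.\<close>
      have upd: "fun_upd h n \<in> ?P n h \<rightarrow>\<^sub>M PiM {0..<Suc n} ?M"
        unfolding measurable_cong_sets[OF IT.sets_P[OF elim(2)] refl]
        by (rule measurable_fun_upd[where J = "{0..<n}"]) (use elim(2) in auto)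
      have "{x \<in> space (PiM {0..<Suc n} ?M). ?cur (Suc n) x \<in> G} \<in> sets (PiM {0..<Suc n} ?M)"
        by (rule predE[OF meas_G])
      then have "(AE y in IT.eP n h. ?cur (Suc n) y \<in> G) \<longleftrightarrow>
          (AE m in ?P n h. ?cur (Suc n) (h(n := m)) \<in> G)"
        unfolding IT.eP_def by (rule AE_distr_iff[OF upd])
      then show ?case
        using move[OF elim(2) elim(1)] by (simp add: current_def)
    qed
    then show ?case
      unfolding IT.C.simps add_0 AE_bind[OF eP meas_G] .
  qed
  have null: "emeasure (path_measure I \<sigma>)
      {\<omega> \<in> space (PiM UNIV ?M). ?cur n \<omega> \<notin> G} = 0 \<and>
      {\<omega> \<in> space (PiM UNIV ?M). ?cur n \<omega> \<notin> G} \<in> sets (path_measure I \<sigma>)" for n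
  proof -
    define X where "X = {h \<in> space (PiM {0..<n} ?M). ?cur n h \<notin> G}"
    have X: "X \<in> sets (PiM {0..<n} ?M)"
      unfolding X_def by measurable
    \<comment> \<open>\<open>?cur n\<close> reads index \<open>n - 1\<close>, or no index at all if
      \<open>n = 0\<close>. The event is therefore a cylinder over the first \<open>n\<close> moves,
      and its measure can be computed in \<open>IT.C 0 n ?u\<close>.\<close>
    have "?cur n (restrict \<omega> {0..<n}) = ?cur n \<omega>"
      for \<omega> :: "nat \<Rightarrow> 'a label \<times> ('s, 'c) nlmp_state"
      by (cases n) (simp_all add: current_def)
    then have emb: "{\<omega> \<in> space (PiM UNIV ?M). ?cur n \<omega> \<notin> G} = prod_emb UNIV ?M {0..<n} X"
      by (auto simp: X_def prod_emb_def space_PiM)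
    have "emeasure IT.PF.lim (prod_emb UNIV ?M {0..<n} X) =
        emeasure (IT.C 0 n ?u) (prod_emb {0..<n} ?M {0..<n} X)"
      using X by (simp add: IT.lim IT.emeasure_CI)
    also have "prod_emb {0..<n} ?M {0..<n} X = X"
      using X by (simp add: prod_emb_id sets.sets_into_space space_PiM[symmetric])
    also have "emeasure (IT.C 0 n ?u) X = 0"
    proof -
      have "sets (IT.C 0 n ?u) = sets (PiM {0..<n} ?M)"
        using IT.sets_C[of ?u 0 n] by (simp add: space_PiM)
      then show ?thesis
        using AE_C[of n] X by (subst (asm) AE_iff_measurable[of X])
          (auto simp: X_def dest: sets_eq_imp_space_eq)
    qed
    finally have *: "emeasure IT.PF.lim (prod_emb UNIV ?M {0..<n} X) = 0" .
    have "prod_emb UNIV ?M {0..<n} X \<in> sets (PiM UNIV ?M)"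
      using X by (intro measurable_prod_emb) auto
    then show ?thesis
      using * unfolding emb path_measure_def by simp
  qed
  have "space (path_measure I \<sigma>) = space (PiM UNIV ?M)"
    unfolding path_measure_def by (rule IT.PF.space_lim)
  then have sub: "{\<omega> \<in> space (path_measure I \<sigma>). \<exists>n. ?cur n \<omega> \<in> B} \<subseteq>
      (\<Union>n. {\<omega> \<in> space (PiM UNIV ?M). ?cur n \<omega> \<notin> G})"
    using B(2) disjoint by blast
  have N: "(\<Union>n. {\<omega> \<in> space (PiM UNIV ?M). ?cur n \<omega> \<notin> G}) \<in> null_sets (path_measure I \<sigma>)"
    using null by (intro null_sets_UN) auto
  show "emeasure (path_measure I \<sigma>)
      {\<omega> \<in> space (path_measure I \<sigma>). \<exists>n. ?cur n \<omega> \<in> B} = 0"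
    by (rule emeasure_eq_0[OF null_setsD2[OF N] null_setsD1[OF N] sub])
qed

section \<open>Resampling clocks\<close>

text \<open>The valuation factor of \<open>jump\<close>, split off so that all computations take
  place in a finite product of probability measures on the reals.\<close>

definition resample :: "('s, 'a, 'c) iosa \<Rightarrow> ('c \<Rightarrow> real) \<Rightarrow> 'c set \<Rightarrow> ('c \<Rightarrow> real) measure" where
  "resample I v C =
     PiM (clocks I) (\<lambda>x. if x \<in> C then clock_dist I x else return borel (v x))"

text \<open>
  With \<open>strict = False\<close> one clock in \<open>A\<close> may have expired, but no two clocks expire at the same
  time.
\<close>

definition race_free :: "bool \<Rightarrow> 'c set \<Rightarrow> ('c \<Rightarrow> real) \<Rightarrow> bool" where
  "race_free strict A v \<longleftrightarrow> inj_on v A \<and> (\<forall>x\<in>A. 0 \<le> v x \<and> (strict \<longrightarrow> v x \<noteq> 0))"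

context IOSA
begin

lemma prob_space_resample_component:
  assumes "C \<subseteq> clocks I"
  shows "prob_space (if x \<in> C then clock_dist I x else return borel (v x :: real))"
  using assms prob_space_clock_dist by (auto intro: prob_space_return)

lemma product_prob_space_resample:
  assumes "C \<subseteq> clocks I"
  shows "product_prob_space (\<lambda>x. if x \<in> C then clock_dist I x else return borel (v x :: real))"
  by (intro product_prob_spaceI prob_space_resample_component assms)

lemma sets_resample:
  assumes "C \<subseteq> clocks I"
  shows "sets (resample I v C) = sets (valuations I)"
  unfolding resample_def valuations_def
  by (rule sets_PiM_cong) (use assms sets_clock_dist in auto)

lemma prob_space_resample:
  assumes "C \<subseteq> clocks I"
  shows "prob_space (resample I v C)"
  unfolding resample_def by (intro prob_space_PiM prob_space_resample_component assms)

text \<open>Boxes form an intersection-stable generator, so this formula yields both the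
  measurability of \<open>resample\<close> in \<open>v\<close> and its composition law.\<close>

lemma emeasure_resample_box:
  assumes "C \<subseteq> clocks I" and "\<And>x. x \<in> clocks I \<Longrightarrow> A x \<in> sets borel"
  shows "emeasure (resample I v C) (Pi\<^sub>E (clocks I) A) =
    (\<Prod>x\<in>clocks I. if x \<in> C then emeasure (clock_dist I x) (A x) else indicator (A x) (v x))"
proof -
  interpret product_prob_space
    "\<lambda>x. if x \<in> C then clock_dist I x else return borel (v x :: real)" "clocks I"
    by (rule product_prob_space_resample[OF assms(1)])
  show ?thesis
    unfolding resample_def
    using assms finite_clocks sets_clock_dist
    by (subst emeasure_PiM) (auto intro!: prod.cong)
qed

text \<open>It suffices to test boxes. There the measure is a finite product of constants and of
  indicators of single coordinates of \<open>v\<close>.\<close>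

lemma measurable_resample:
  assumes "C \<subseteq> clocks I"
  shows "(\<lambda>v. resample I v C) \<in> valuations I \<rightarrow>\<^sub>M prob_algebra (valuations I)"
proof (rule measurable_prob_algebra_generated)
  let ?G = "prod_algebra (clocks I) (\<lambda>_. borel :: real measure)"
  show "sets (valuations I) = sigma_sets (\<Pi>\<^sub>E x\<in>clocks I. space (borel :: real measure)) ?G"
    unfolding valuations_def by (rule sets_PiM)
  show "Int_stable ?G"
    by (rule Int_stable_prod_algebra)
  show "?G \<subseteq> Pow (\<Pi>\<^sub>E x\<in>clocks I. space (borel :: real measure))"
    by (rule prod_algebra_sets_into_space)
  fix B assume "B \<in> ?G"
  then obtain A :: "'c \<Rightarrow> real set" where B: "B = Pi\<^sub>E (clocks I) A"
    and A: "\<And>x. x \<in> clocks I \<Longrightarrow> A x \<in> sets borel"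
    by (auto simp: prod_algebra_eq_finite[OF finite_clocks])
  have "(\<lambda>v. if x \<in> C then emeasure (clock_dist I x) (A x) else indicator (A x) (v x))
      \<in> borel_measurable (valuations I)" if "x \<in> clocks I" for x
    using that A[OF that] unfolding valuations_def by (cases "x \<in> C") simp_all
  then show "(\<lambda>v. emeasure (resample I v C) B) \<in> borel_measurable (valuations I)"
    by (simp add: B emeasure_resample_box[OF assms A] borel_measurable_prod_ennreal)
qed (use assms in \<open>auto simp: prob_space_resample sets_resample\<close>)

text \<open>On a box the integrand is a product over the clocks, hence so is the integral. A clock
  in \<open>D\<close> forgets its intermediate value, and any other clock keeps the value given to
  it by the first resampling.\<close>

lemma bind_resample:
  assumes C: "C \<subseteq> clocks I" and D: "D \<subseteq> clocks I"
  shows "resample I v C \<bind> (\<lambda>w. resample I w D) = resample I v (C \<union> D)"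
proof -
  interpret U: product_prob_space
    "\<lambda>x. if x \<in> C \<union> D then clock_dist I x else return borel (v x :: real)" "clocks I"
    by (rule product_prob_space_resample) (use C D in simp)
  interpret V: product_prob_space
    "\<lambda>x. if x \<in> C then clock_dist I x else return borel (v x :: real)" "clocks I"
    by (rule product_prob_space_resample[OF C])
  have K: "(\<lambda>w. resample I w D) \<in> resample I v C \<rightarrow>\<^sub>M subprob_algebra (valuations I)"
    unfolding measurable_cong_sets[OF sets_resample[OF C] refl]
    by (rule measurable_prob_algebraD[OF measurable_resample[OF D]])
  have ne: "space (resample I v C) \<noteq> {}"
    by (rule prob_space.not_empty[OF prob_space_resample[OF C]])
  show ?thesis
    unfolding resample_def[of I v "C \<union> D"]
  proof (rule U.PiM_eqI[OF finite_clocks])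
    show "sets (resample I v C \<bind> (\<lambda>w. resample I w D)) =
        sets (PiM (clocks I) (\<lambda>x. if x \<in> C \<union> D then clock_dist I x else return borel (v x)))"
      unfolding sets_bind_measurable[OF K ne] using sets_resample[of "C \<union> D" v] C D
      by (simp add: resample_def)
    fix A assume A_sets: "\<And>x. x \<in> clocks I \<Longrightarrow>
      A x \<in> sets (if x \<in> C \<union> D then clock_dist I x else return borel (v x))"
    have A: "A x \<in> sets borel" if "x \<in> clocks I" for x
      using A_sets[OF that] sets_clock_dist[OF that] by (simp split: if_splits)
    \<comment> \<open>The probability that clock \<open>x\<close> lies in \<open>A x\<close> after
      the second resampling, given the value \<open>r\<close> before it.\<close>
    let ?f = "\<lambda>x r. if x \<in> D then emeasure (clock_dist I x) (A x) else indicator (A x) r"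
    have box: "Pi\<^sub>E (clocks I) A \<in> sets (valuations I)"
      unfolding valuations_def by (intro sets_PiM_I_finite finite_clocks A)
    have "emeasure (resample I v C \<bind> (\<lambda>w. resample I w D)) (Pi\<^sub>E (clocks I) A) =
        (\<integral>\<^sup>+w. (\<Prod>x\<in>clocks I. ?f x (w x)) \<partial>resample I v C)"
      unfolding emeasure_bind[OF ne K box]
      by (rule nn_integral_cong) (intro emeasure_resample_box D A)
    also have "\<dots> = (\<Prod>x\<in>clocks I.
        \<integral>\<^sup>+r. ?f x r \<partial>(if x \<in> C then clock_dist I x else return borel (v x)))"
      unfolding resample_def
    proof (rule V.product_nn_integral_prod[where f = ?f, OF finite_clocks])
      fix x assume "x \<in> clocks I"
      then have "A x \<in> sets (if x \<in> C then clock_dist I x else return borel (v x))"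
        using A sets_clock_dist by simp
      then show "?f x \<in> borel_measurable (if x \<in> C then clock_dist I x else return borel (v x))"
        by (cases "x \<in> D") (simp_all only: if_True if_False borel_measurable_const
            borel_measurable_indicator)
    qed
    also have "\<dots> = (\<Prod>x\<in>clocks I.
        emeasure (if x \<in> C \<union> D then clock_dist I x else return borel (v x)) (A x))"
    proof (rule prod.cong[OF refl])
      fix x assume x: "x \<in> clocks I"
      have P: "prob_space (if x \<in> C then clock_dist I x else return borel (v x))"
        by (rule prob_space_resample_component[OF C])
      show "(\<integral>\<^sup>+r. ?f x r \<partial>(if x \<in> C then clock_dist I x else return borel (v x))) =
          emeasure (if x \<in> C \<union> D then clock_dist I x else return borel (v x)) (A x)"
      proof (cases "x \<in> D")
        case True
        then show ?thesis
          by (simp only: if_True Un_iff simp_thms nn_integral_const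
              prob_space.emeasure_space_1[OF P] mult_1_right)
      next
        case False
        have "A x \<in> sets (if x \<in> C then clock_dist I x else return borel (v x))"
          using A[OF x] sets_clock_dist[OF x] by simp
        with False show ?thesis
          by (simp only: if_False Un_iff simp_thms nn_integral_indicator)
      qed
    qed
    finally show "emeasure (resample I v C \<bind> (\<lambda>w. resample I w D)) (Pi\<^sub>E (clocks I) A) =
        (\<Prod>x\<in>clocks I.
          emeasure (if x \<in> C \<union> D then clock_dist I x else return borel (v x)) (A x))" .
  qed
qed

section \<open>Almost sure properties of resampled clocks\<close>

lemma AE_resample_fresh:
  assumes "C \<subseteq> clocks I" "x \<in> C"
  shows "AE w in resample I v C. 0 < w x"
proof -
  have x: "x \<in> clocks I" using assms by auto
  interpret prob_space "clock_dist I x" by (rule prob_space_clock_dist[OF x])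
  have "AE r in clock_dist I x. r \<in> {0<..}"
    using positive_clock_dist[OF x] sets_clock_dist[OF x]
    by (subst AE_in_set_eq_1) (auto simp: measure_def)
  then show ?thesis
    unfolding resample_def using x assms(2)
    by (intro AE_PiM_component prob_space_resample_component assms) auto
qed

lemma AE_resample_kept:
  assumes "C \<subseteq> clocks I" "x \<in> clocks I - C"
  shows "AE w in resample I v C. w x = v x"
  unfolding resample_def using assms
  by (intro AE_PiM_component prob_space_resample_component assms) (auto simp: AE_return)

text \<open>By Fubini: with all clocks other than \<open>x\<close> fixed, a tie forces
  \<open>x\<close> into the single point \<open>w y\<close>, which is null because clock
  distributions have no atoms. The clock \<open>y\<close> may be resampled or kept.\<close>

lemma AE_resample_distinct:
  assumes C: "C \<subseteq> clocks I" and x: "x \<in> C" and y: "y \<in> clocks I" "x \<noteq> y"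
  shows "AE w in resample I v C. w x \<noteq> w y"
proof -
  let ?M = "\<lambda>x. if x \<in> C then clock_dist I x else return borel (v x)"
  interpret product_prob_space ?M "clocks I"
    by (rule product_prob_space_resample[OF C])
  define J where "J = clocks I - {x}"
  have J: "clocks I = insert x J" "finite J" "x \<notin> J" "y \<in> J"
    using finite_clocks C x y by (auto simp: J_def)
  have xc: "x \<in> clocks I" using C x by auto
  have [measurable]: "(\<lambda>w. w z) \<in> borel_measurable (PiM (clocks I) ?M)" if "z \<in> clocks I" for z
    using that sets_resample[OF C] measurable_component_singleton[of z "clocks I" "\<lambda>_. borel"]
    unfolding measurable_cong_sets[OF sets_resample[OF C, unfolded resample_def] refl]
    by (simp add: valuations_def)
  have meas: "{w \<in> space (PiM (clocks I) ?M). w x = w y} \<in> sets (PiM (clocks I) ?M)"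
    using xc y by measurable
  have "emeasure (PiM (clocks I) ?M) {w \<in> space (PiM (clocks I) ?M). w x = w y} =
      (\<integral>\<^sup>+w. indicator {w \<in> space (PiM (clocks I) ?M). w x = w y} w \<partial>PiM (clocks I) ?M)"
    using meas by simp
  also have "\<dots> = (\<integral>\<^sup>+w. (\<integral>\<^sup>+r. indicator {w \<in> space (PiM (clocks I) ?M). w x = w y} (w(x := r))
      \<partial>?M x) \<partial>PiM J ?M)"
    using meas unfolding J(1) by (intro product_nn_integral_insert J) simp
  \<comment> \<open>Updating \<open>x\<close> leaves \<open>w y\<close> unchanged since
    \<open>x\<close> and \<open>y\<close> differ. Membership in the space is dropped here, hence
    only an inequality.\<close>
  also have "\<dots> \<le> (\<integral>\<^sup>+w. (\<integral>\<^sup>+r. indicator {w y} r \<partial>clock_dist I x) \<partial>PiM J ?M)"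
    using x y by (auto intro!: nn_integral_mono split: split_indicator)
  also have "\<dots> = 0"
    using continuous_clock_dist[OF xc] sets_clock_dist[OF xc] by simp
  finally have "emeasure (PiM (clocks I) ?M) {w \<in> space (PiM (clocks I) ?M). w x = w y} = 0"
    by simp
  then show ?thesis
    unfolding resample_def using meas by (subst AE_iff_measurable) auto
qed

text \<open>Fresh values are almost surely positive and differ from all other values, so the old
  valuation matters only on the clocks that are kept.\<close>

lemma AE_resample_race_free:
  assumes C: "C \<subseteq> clocks I" and A: "A \<subseteq> clocks I" and v: "race_free strict (A - C) v"
  shows "AE w in resample I v C. race_free strict A w"
proof -
  have fin: "finite A" using A finite_clocks finite_subset by blast
  have "AE w in resample I v C. \<forall>x\<in>A. if x \<in> C then 0 < w x else w x = v x"
    using fin A AE_resample_fresh[OF C] AE_resample_kept[OF C]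
    by (intro AE_finite_allI) auto
  moreover have "AE w in resample I v C. \<forall>x\<in>A. \<forall>y\<in>A. x \<in> C \<longrightarrow> x \<noteq> y \<longrightarrow> w x \<noteq> w y"
    using fin A AE_resample_distinct[OF C] by (intro AE_finite_allI) auto
  ultimately show ?thesis
  proof eventually_elim
    case (elim w)
    have "w x \<noteq> w y" if "x \<in> A" "y \<in> A" "x \<noteq> y" for x y
    proof (cases "x \<in> C \<or> y \<in> C")
      case True
      then show ?thesis using elim(2) that by metis
    next
      case False
      then have "v x \<noteq> v y"
        using v that unfolding race_free_def inj_on_def by blast
      then show ?thesis using elim(1) that False by simp
    qed
    then have "inj_on w A" by (auto simp: inj_on_def)
    moreover have "0 \<le> w x \<and> (strict \<longrightarrow> w x \<noteq> 0)" if "x \<in> A" for x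
      using elim(1) v that by (cases "x \<in> C") (auto simp: race_free_def)
    ultimately show ?case by (simp add: race_free_def)
  qed
qed

section \<open>Jumps as image measures of resampled valuations\<close>

lemma measurable_Pair_location:
  assumes "q \<in> locations I"
  shows "Pair q \<in> valuations I \<rightarrow>\<^sub>M state_space I"
  unfolding state_space_def using assms by (intro measurable_Pair1') simp

text \<open>The location after a jump is deterministic, so the product with a Dirac measure is an
  image measure. This reduces binds, measurability and almost sure statements about
  \<open>jump\<close> to those about \<open>resample\<close>.\<close>

lemma jump_eq_distr:
  assumes C: "C \<subseteq> clocks I" and s: "s \<in> states I"
  shows "jump I v C s = distr (resample I v C) (state_space I) (Pair (Some s))"
proof -
  interpret R: prob_space "resample I v C" by (rule prob_space_resample[OF C])
  have loc: "Some s \<in> locations I" using s by (simp add: locations_def)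
  have Pair: "Pair (Some s) \<in> resample I v C \<rightarrow>\<^sub>M state_space I"
    unfolding measurable_cong_sets[OF sets_resample[OF C] refl]
    by (rule measurable_Pair_location[OF loc])
  interpret L: prob_space "return (count_space (locations I)) (Some s)"
    by (rule prob_space_return) (simp add: loc)
  show ?thesis
    unfolding jump_def resample_def[symmetric]
  proof (rule pair_measure_eqI)
    show "sigma_finite_measure (return (count_space (locations I)) (Some s))"
      by (rule L.sigma_finite_measure_axioms)
    show "sigma_finite_measure (resample I v C)"
      by (rule R.sigma_finite_measure_axioms)
    show "sets (return (count_space (locations I)) (Some s) \<Otimes>\<^sub>M resample I v C) =
        sets (distr (resample I v C) (state_space I) (Pair (Some s)))"
      unfolding sets_distr state_space_def
      by (rule sets_pair_measure_cong) (simp_all add: sets_resample[OF C])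
    fix A B
    assume A: "A \<in> sets (return (count_space (locations I)) (Some s))"
      and B: "B \<in> sets (resample I v C)"
    have "A \<times> B \<in> sets (state_space I)"
      using A B unfolding state_space_def sets_resample[OF C] by auto
    moreover have "Pair (Some s) -` (A \<times> B) \<inter> space (resample I v C) =
        (if Some s \<in> A then B else {})"
      using sets.sets_into_space[OF B] by auto
    ultimately show "emeasure (return (count_space (locations I)) (Some s)) A *
        emeasure (resample I v C) B =
        emeasure (distr (resample I v C) (state_space I) (Pair (Some s))) (A \<times> B)"
      using A by (simp add: emeasure_distr[OF Pair])
  qed
qed

lemma measurable_jump:
  assumes C: "C \<subseteq> clocks I" and s: "s \<in> states I"
  shows "(\<lambda>v. jump I v C s) \<in> valuations I \<rightarrow>\<^sub>M prob_algebra (state_space I)"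
proof -
  have "Some s \<in> locations I" using s by (simp add: locations_def)
  then show ?thesis
    unfolding jump_eq_distr[OF assms]
    by (rule measurable_compose[OF measurable_resample[OF C]
        measurable_distr_prob_space[OF measurable_Pair_location]])
qed

text \<open>Evaluates the integral in the second rule for weak transitions. The function
  \<open>f\<close> is prescribed only at the location \<open>s\<close>, where the first jump is
  concentrated.\<close>

lemma bind_jump:
  assumes C: "C \<subseteq> clocks I" and s: "s \<in> states I" and D: "D \<subseteq> clocks I" and t: "t \<in> states I"
    and f: "f \<in> state_space I \<rightarrow>\<^sub>M subprob_algebra (state_space I)"
    and f_eq: "\<And>w. f (Some s, w) = jump I w D t"
  shows "jump I v C s \<bind> f = jump I v (C \<union> D) t"
proof -
  have loc: "Some s \<in> locations I" "Some t \<in> locations I"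
    using s t by (simp_all add: locations_def)
  have ne: "space (resample I v C) \<noteq> {}"
    by (rule prob_space.not_empty[OF prob_space_resample[OF C]])
  have Pair: "Pair (Some s) \<in> resample I v C \<rightarrow>\<^sub>M state_space I"
    unfolding measurable_cong_sets[OF sets_resample[OF C] refl]
    by (rule measurable_Pair_location[OF loc(1)])
  have K: "(\<lambda>w. resample I w D) \<in> resample I v C \<rightarrow>\<^sub>M subprob_algebra (valuations I)"
    unfolding measurable_cong_sets[OF sets_resample[OF C] refl]
    by (rule measurable_prob_algebraD[OF measurable_resample[OF D]])
  have "jump I v C s \<bind> f = resample I v C \<bind> (\<lambda>w. f (Some s, w))"
    unfolding jump_eq_distr[OF C s] by (rule bind_distr[OF Pair f ne])
  also have "\<dots> = resample I v C \<bind> (\<lambda>w. distr (resample I w D) (state_space I) (Pair (Some t)))"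
    by (simp add: f_eq jump_eq_distr[OF D t])
  also have "\<dots> = distr (resample I v C \<bind> (\<lambda>w. resample I w D)) (state_space I) (Pair (Some t))"
    by (rule distr_bind[OF K ne measurable_Pair_location[OF loc(2)], symmetric])
  also have "\<dots> = jump I v (C \<union> D) t"
    using C D by (simp add: bind_resample[OF C D] jump_eq_distr[OF _ t])
  finally show ?thesis .
qed

lemma countable_locations: "countable (locations I)"
  using countable_states by (simp add: locations_def)

lemma null_measure_in_subprob_algebra:
  "null_measure (state_space I) \<in> space (subprob_algebra (state_space I))"
proof -
  \<comment> \<open>Subprobability spaces have to be nonempty; the zero valuation at the location
    \<open>init\<close> is a witness.\<close>
  have "(None, \<lambda>x\<in>clocks I. 0) \<in> space (state_space I)"
    by (auto simp: state_space_def space_pair_measure locations_def valuations_def space_PiM)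
  then show ?thesis
    by (auto simp: space_subprob_algebra intro!: subprob_spaceI)
qed

end

section \<open>Confluent urgent runs\<close>

text \<open>The part of a weak transition that does not involve valuations. Unlike
  \<open>weak_n\<close>, it admits length 0, at stable states, which gives the inductions a simpler
  base case.\<close>

primrec urgent_run :: "('s, 'a, 'c) iosa \<Rightarrow> nat \<Rightarrow> 'c set \<Rightarrow> 's \<Rightarrow> 's \<Rightarrow> bool" where
  "urgent_run I 0 C s t \<longleftrightarrow> C = {} \<and> s = t \<and> is_stable I t"
| "urgent_run I (Suc n) C s t \<longleftrightarrow>
    (\<exists>C' C'' s'. step I s {} (silent I) C' s' \<and> C = C' \<union> C'' \<and> urgent_run I n C'' s' t)"

text \<open>The situation after \<open>rename_urgent\<close> has been applied to a closed confluent
  automaton.\<close>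

locale confluent_silent_iosa = IOSA I for I :: "('s, 'a, 'c) iosa" +
  assumes no_inputs: "inputs I = {}"
    and urgent_silent: "urgent I = {silent I}"
    and confluent: "confluent I"
begin

lemma not_stable_iff: "\<not> is_stable I s \<longleftrightarrow> (\<exists>C s'. step I s {} (silent I) C s')"
  using silent_action by (auto simp: is_stable_def urgent_silent)

lemma diamond:
  assumes "step I s {} (silent I) C1 s1" "step I s {} (silent I) C2 s2" "(C1, s1) \<noteq> (C2, s2)"
  obtains s3 where "step I s1 {} (silent I) C2 s3" "step I s2 {} (silent I) C1 s3"
  using confluent assms unfolding confluent_def confluent_wrt_def urgent_silent by blast

lemma urgent_run_carrier:
  assumes "urgent_run I n C s t" "s \<in> states I"
  shows "C \<subseteq> clocks I \<and> t \<in> states I"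
  using assms
proof (induction n arbitrary: C s)
  case (Suc n)
  then show ?case using step_carrier by (fastforce simp del: Un_subset_iff)
qed simp

text \<open>Any urgent transition out of \<open>s\<close> can be moved to the front of a complete
  run: diamonds push it past the earlier transitions one by one. This preserves the endpoint, the
  length and the union of the resampled clocks.\<close>

lemma urgent_run_swap:
  assumes "urgent_run I (Suc n) C s t" "step I s {} (silent I) D s2"
  shows "\<exists>C2. urgent_run I n C2 s2 t \<and> C = D \<union> C2"
  using assms
proof (induction n arbitrary: C s D s2)
  case 0
  then obtain C' s' where s': "step I s {} (silent I) C' s'" "C = C'" "s' = t" "is_stable I t"
    by auto
  \<comment> \<open>Otherwise the diamond would provide an urgent transition out of the stable state
    \<open>t\<close>.\<close>
  then have "(C', s') = (D, s2)"
    using diamond[OF s'(1) 0(2)] not_stable_iff by metis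
  then show ?case using s' by auto
next
  case (Suc n)
  from Suc.prems(1) obtain C' C'' s' where s': "step I s {} (silent I) C' s'" "C = C' \<union> C''"
    "urgent_run I (Suc n) C'' s' t"
    by (subst (asm) urgent_run.simps) blast
  show ?case
  proof (cases "(C', s') = (D, s2)")
    case True
    then show ?thesis using s' by blast
  next
    case False
    obtain s3 where s3: "step I s' {} (silent I) D s3" "step I s2 {} (silent I) C' s3"
      using diamond[OF s'(1) Suc.prems(2) False] .
    \<comment> \<open>The induction hypothesis removes the \<open>D\<close>-transition from the
      tail. The other side of the diamond then puts the \<open>C'\<close>-transition in front again,
      now starting in \<open>s2\<close>.\<close>
    obtain C3 where C3: "urgent_run I n C3 s3 t" "C'' = D \<union> C3"
      using Suc.IH[OF s'(3) s3(1)] by blast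
    have "urgent_run I (Suc n) (C' \<union> C3) s2 t"
      using s3(2) C3(1) by auto
    moreover have "C = D \<union> (C' \<union> C3)"
      using s'(2) C3(2) by auto
    ultimately show ?thesis by blast
  qed
qed

text \<open>\<open>urgent_run_swap\<close> rearranges the first run so that it begins with the first
  transition of the second, after which the tails are compared by induction. Intermediate states may
  still differ.\<close>

lemma urgent_run_unique:
  assumes "urgent_run I n C s t" "urgent_run I m D s u"
  shows "n = m \<and> C = D \<and> t = u"
  using assms
proof (induction n arbitrary: m C D s)
  case 0
  show ?case
  proof (cases m)
    case (Suc k)
    then show ?thesis using 0 not_stable_iff by auto
  qed (use 0 in auto)
next
  case (Suc n)
  then have "\<not> is_stable I s" using not_stable_iff by auto
  with Suc.prems(2) obtain k where m: "m = Suc k"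
    by (cases m) auto
  with Suc.prems(2) obtain D' D'' s' where s': "step I s {} (silent I) D' s'" "D = D' \<union> D''"
    "urgent_run I k D'' s' u" by auto
  obtain C2 where C2: "urgent_run I n C2 s' t" "C = D' \<union> C2"
    using urgent_run_swap[OF Suc.prems(1) s'(1)] by metis
  then show ?case using Suc.IH[OF C2(1) s'(3)] s'(2) m by simp
qed

section \<open>Weak transitions as single jumps\<close>

text \<open>The assumption is the induction hypothesis of \<open>weak_n_iff_run\<close>. Uniqueness
  of runs makes the definite description in \<open>weak_fun\<close> denote the jump.\<close>

lemma weak_fun_run:
  assumes "\<And>s v \<mu>. weak_n I n C (Some s, v) \<mu> \<longleftrightarrow> (\<exists>t. urgent_run I n C s t \<and> \<mu> = jump I v C t)"
  shows "urgent_run I n C s t \<Longrightarrow> weak_fun I (weak_n I n C) (Some s, v) = jump I v C t"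
    and "\<nexists>t. urgent_run I n C s t \<Longrightarrow>
      weak_fun I (weak_n I n C) (Some s, v) = null_measure (state_space I)"
proof -
  assume run: "urgent_run I n C s t"
  then have "weak_n I n C (Some s, v) \<mu> \<longleftrightarrow> \<mu> = jump I v C t" for \<mu>
    using assms urgent_run_unique by blast
  then have "weak_n I n C (Some s, v) = (\<lambda>\<mu>. \<mu> = jump I v C t)"
    by blast
  then show "weak_fun I (weak_n I n C) (Some s, v) = jump I v C t"
    by (simp add: weak_fun_def)
qed (auto simp: weak_fun_def assms)

text \<open>There are countably many locations, and at each of them the function is either a jump
  for all valuations or null for all valuations.\<close>

lemma measurable_weak_fun:
  assumes "\<And>s v \<mu>. weak_n I n C (Some s, v) \<mu> \<longleftrightarrow> (\<exists>t. urgent_run I n C s t \<and> \<mu> = jump I v C t)"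
  shows "weak_fun I (weak_n I n C) \<in> state_space I \<rightarrow>\<^sub>M subprob_algebra (state_space I)"
  unfolding state_space_def[of I]
proof (rule measurable_pair_measure_countable1[OF countable_locations])
  fix q assume q: "q \<in> locations I"
  have "(\<lambda>v. weak_fun I (weak_n I n C) (q, v)) \<in>
      valuations I \<rightarrow>\<^sub>M subprob_algebra (state_space I)"
  proof (cases q)
    case None
    have "weak_fun I (weak_n I n C) (None, v) = null_measure (state_space I)" for v
      by (cases n) (simp_all add: weak_fun_def)
    then show ?thesis
      using measurable_const[OF null_measure_in_subprob_algebra] by (simp add: None)
  next
    case (Some s)
    then have s: "s \<in> states I" using q by (auto simp: locations_def)
    show ?thesis
    proof (cases "\<exists>t. urgent_run I n C s t")
      case True
      then obtain t where t: "urgent_run I n C s t" by blast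
      then have "C \<subseteq> clocks I" "t \<in> states I" using urgent_run_carrier[OF t s] by auto
      then show ?thesis
        by (simp add: Some weak_fun_run(1)[OF assms t] measurable_prob_algebraD[OF measurable_jump])
    next
      case False
      then show ?thesis
        using measurable_const[OF null_measure_in_subprob_algebra]
        by (simp add: Some weak_fun_run(2)[OF assms False])
    qed
  qed
  then show "(\<lambda>v. weak_fun I (weak_n I n C) (q, v)) \<in>
      valuations I \<rightarrow>\<^sub>M subprob_algebra (count_space (locations I) \<Otimes>\<^sub>M valuations I)"
    by (simp add: state_space_def)
qed

text \<open>The integral in the second rule collapses to one jump by \<open>bind_jump\<close>.
  Indices start at \<open>Suc n\<close> because \<open>weak_n I 0\<close> never holds, whereas runs
  of length 0 exist.\<close>

lemma weak_n_iff_run: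
  "weak_n I (Suc n) C (Some s, v) \<mu> \<longleftrightarrow> (\<exists>t. urgent_run I (Suc n) C s t \<and> \<mu> = jump I v C t)"
proof (induction n arbitrary: C s v \<mu>)
  case 0
  then show ?case by auto
next
  case (Suc n)
  note m = measurable_weak_fun[of "Suc n", OF Suc.IH] and r = weak_fun_run(1)[of "Suc n", OF Suc.IH]
  have bind: "jump I v C' s' \<bind> weak_fun I (weak_n I (Suc n) C'') = jump I v (C' \<union> C'') t"
    if "step I s {} (silent I) C' s'" "urgent_run I (Suc n) C'' s' t" for C' C'' s' t v
    using step_carrier[OF that(1)] urgent_run_carrier[OF that(2)]
    by (intro bind_jump m r that(2)) auto
  \<comment> \<open>Without a valuation the universal premise of the second rule would hold
    vacuously and would not yield a run.\<close>
  have "space (valuations I) \<noteq> {}"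
    by (simp add: valuations_def space_PiM PiE_eq_empty_iff)
  then have en: "(\<forall>v'\<in>space (valuations I). \<exists>\<mu>'. weak_n I (Suc n) C'' (Some s', v') \<mu>') \<longleftrightarrow>
      (\<exists>t. urgent_run I (Suc n) C'' s' t)" for C'' s'
    unfolding Suc.IH by blast
  show ?case
    unfolding weak_n.simps(2)[of I "Suc n"] urgent_run.simps(2)[of I "Suc n"] en
    using bind by (simp del: weak_n.simps urgent_run.simps) metis
qed

text \<open>Both measures are jumps along urgent runs from \<open>s\<close>, and such runs agree in
  clocks and endpoint even if their lengths are not assumed equal.\<close>

lemma weak_unique:
  assumes "weak I (Some s, v) \<mu>" "weak I (Some s, v) \<nu>"
  shows "\<mu> = \<nu>"
proof -
  have "\<exists>n C t. urgent_run I n C s t \<and> \<mu> = jump I v C t" if "weak I (Some s, v) \<mu>" for \<mu>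
    using that weak_n_iff_run unfolding weak_def by (metis Suc_le_D One_nat_def)
  from this[OF assms(1)] this[OF assms(2)]
  obtain n C t m D u where "urgent_run I n C s t" "\<mu> = jump I v C t"
    "urgent_run I m D s u" "\<nu> = jump I v D u" by metis
  then show ?thesis
    using urgent_run_unique[of n C s t m D u] by simp
qed

lemma weak_well_defined: "weak_well_defined I"
  unfolding weak_well_defined_def
proof (intro allI impI conjI ballI)
  fix n :: nat and C assume n: "1 \<le> n" and C: "C \<subseteq> clocks I"
  then obtain m where m: "n = Suc m" by (cases n) auto
  show "weak_fun I (weak_n I n C) \<in> state_space I \<rightarrow>\<^sub>M subprob_algebra (state_space I)"
    unfolding m by (rule measurable_weak_fun[OF weak_n_iff_run])
  fix z \<nu> \<nu>' assume \<nu>: "weak_n I n C z \<nu>" "weak_n I n C z \<nu>'"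
  then obtain s v where "z = (Some s, v)" unfolding m by auto
  then show "\<nu> = \<nu>'"
    using \<nu> n C weak_unique[of s v] unfolding weak_def by blast
qed

section \<open>Absence of races\<close>

text \<open>The invariant for \<open>almost_never_reachedI\<close>. Strictness is tied to non-stable
  states: an expired clock is tolerated only where it can fire without competing with an urgent
  output.\<close>

definition good_states :: "('s \<Rightarrow> 'c set) \<Rightarrow> ('s, 'c) nlmp_state set" where
  "good_states active = {z \<in> space (state_space I).
     \<forall>s. fst z = Some s \<longrightarrow> race_free (\<not> is_stable I s) (active s) (snd z)}"

lemma sets_good_states:
  assumes active: "\<And>s. s \<in> states I \<Longrightarrow> active s \<subseteq> clocks I"
  shows "good_states active \<in> sets (state_space I)"
proof -
  have "Measurable.pred (count_space (locations I) \<Otimes>\<^sub>M valuations I)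
      (\<lambda>z. \<forall>s. fst z = Some s \<longrightarrow> race_free (\<not> is_stable I s) (active s) (snd z))"
  proof (rule measurable_pair_measure_countable1[OF countable_locations])
    fix q assume q: "q \<in> locations I"
    show "Measurable.pred (valuations I) (\<lambda>v. \<forall>s. fst (q, v) = Some s \<longrightarrow>
        race_free (\<not> is_stable I s) (active s) (snd (q, v)))"
    proof (cases q)
      case (Some s)
      then have "active s \<subseteq> clocks I" using q active by (auto simp: locations_def)
      then have fin: "finite (active s)"
        using finite_clocks finite_subset by blast
      have comp: "(\<lambda>v. v x) \<in> borel_measurable (valuations I)" if "x \<in> active s" for x
        using that \<open>active s \<subseteq> clocks I\<close> unfolding valuations_def by auto
      have "Measurable.pred (valuations I) (\<lambda>v. v x = v y)"
        if "x \<in> active s" "y \<in> active s" for x y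
        using borel_measurable_eq[OF comp[OF that(1)] comp[OF that(2)]] by (simp add: pred_def)
      moreover have "Measurable.pred (valuations I) (\<lambda>v. 0 \<le> v x)" if "x \<in> active s" for x
        using borel_measurable_le[OF borel_measurable_const comp[OF that], of 0]
        by (simp add: pred_def)
      moreover have "Measurable.pred (valuations I) (\<lambda>v. v x = 0)" if "x \<in> active s" for x
        using borel_measurable_eq[OF comp[OF that] borel_measurable_const, of 0]
        by (simp add: pred_def)
      ultimately have "Measurable.pred (valuations I) (\<lambda>v. (\<forall>x\<in>active s. \<forall>y\<in>active s. v x = v y \<longrightarrow> x = y) \<and>
          (\<forall>x\<in>active s. 0 \<le> v x \<and> (\<not> is_stable I s \<longrightarrow> v x \<noteq> 0)))"
        using fin by (intro pred_intros_logic pred_intros_finite) simp_all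
      then show ?thesis
        by (simp add: Some race_free_def inj_on_def)
    qed simp
  qed
  then show ?thesis
    unfolding good_states_def state_space_def[symmetric] by (rule predE)
qed

lemma AE_jump_good_states:
  assumes "C \<subseteq> clocks I" "s \<in> states I"
    and active: "\<And>t. t \<in> states I \<Longrightarrow> active t \<subseteq> clocks I"
    and "race_free (\<not> is_stable I s) (active s - C) v"
  shows "AE z in jump I v C s. z \<in> good_states active"
proof -
  have loc: "Some s \<in> locations I" using assms(2) by (simp add: locations_def)
  have Pair: "Pair (Some s) \<in> resample I v C \<rightarrow>\<^sub>M state_space I"
    unfolding measurable_cong_sets[OF sets_resample[OF assms(1)] refl]
    by (rule measurable_Pair_location[OF loc])
  have "AE w in resample I v C. race_free (\<not> is_stable I s) (active s) w"
    by (rule AE_resample_race_free) (use assms in auto)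
  then have "AE w in resample I v C. (Some s, w) \<in> good_states active"
    using AE_space
    by eventually_elim (use measurable_space[OF Pair] in \<open>auto simp: good_states_def\<close>)
  then show ?thesis
    using sets_good_states[of active, OF active]
    unfolding jump_eq_distr[OF assms(1,2)] by (subst AE_distr_iff[OF Pair]) simp_all
qed

text \<open>In a stable state the action is a non-urgent output governed by one clock
  \<open>y\<close>, which is both nonnegative and expired, hence zero. By distinctness no other
  clock in \<open>A\<close> is zero, so discarding \<open>y\<close> gives strictness.\<close>

lemma race_free_step:
  assumes v: "race_free (\<not> is_stable I s) A v" and enabling: "enabling I s \<subseteq> A"
    and step: "step I s C a C' s'" and C: "\<forall>x\<in>C. v x \<le> 0"
  shows "race_free True (A - C) v"
proof (cases "is_stable I s")
  case False
  then show ?thesis using v by (auto simp: race_free_def intro: inj_on_subset)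
next
  case True
  then have "a \<noteq> silent I"
    using step step_reactive[OF step] not_stable_iff urgent_silent by auto
  then have "a \<in> outputs I - urgent I"
    using step_carrier[OF step] no_inputs urgent_silent by auto
  then obtain y where y: "C = {y}"
    using step_generative[OF step] by auto
  then have "y \<in> A" using step enabling by (auto simp: enabling_def)
  then have "v y = 0" using C v y by (force simp: race_free_def)
  then have "v x \<noteq> 0" if "x \<in> A - C" for x
    using that v \<open>y \<in> A\<close> y unfolding race_free_def inj_on_def by fastforce
  then show ?thesis
    using v by (auto simp: race_free_def intro: inj_on_subset)
qed

text \<open>Two actions ready in a stable state have clocks equal to zero, hence the same clock, and
  \<open>clock_deterministic\<close> applies. In a non-stable state weak transitions are unique, and
  strictness leaves no clock expired.\<close>

lemma good_state_not_nondeterministic: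
  assumes z: "z \<in> good_states active"
    and enabling: "\<And>s. s \<in> states I \<Longrightarrow> enabling I s \<subseteq> active s"
  shows "\<not> nondeterministic_state I z"
proof (cases "fst z")
  case None
  then obtain v where "z = (None, v)" by (cases z) auto
  then show ?thesis
    by (auto simp: nondeterministic_state_def stable_location_def)
next
  case (Some s)
  then obtain v where zv: "z = (Some s, v)" by (cases z) auto
  have s: "s \<in> states I" and rf: "race_free (\<not> is_stable I s) (active s) v"
    using z unfolding zv good_states_def
    by (auto simp: state_space_def space_pair_measure locations_def)
  have zero: "x \<in> active s \<and> v x = 0" if "step I s {x} a C' s'" "v x \<le> 0" for x a C' s'
    using that enabling[OF s] rf unfolding race_free_def enabling_def by force
  have stable: "\<mu> = \<mu>'" if st: "is_stable I s"
    and \<mu>: "\<mu> \<in> nlmp I (Act a) z" and \<mu>': "\<mu>' \<in> nlmp I (Act a') z" for a a' \<mu> \<mu>'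
  proof -
    \<comment> \<open>Stability rules out the silent action, and there are no inputs, so every ready
      action is triggered by exactly one clock.\<close>
    have *: "\<exists>x b C' s'. step I s {x} b C' s' \<and> v x \<le> 0 \<and> \<nu> = jump I v C' s'"
      if "\<nu> \<in> nlmp I (Act b) z" for \<nu> b
    proof -
      from that obtain C C' s' where step: "step I s C b C' s'" "\<forall>x\<in>C. v x \<le> 0"
        "\<nu> = jump I v C' s'" by (auto simp: zv)
      have "b \<noteq> silent I"
        using st step(1) step_reactive[OF step(1)] not_stable_iff urgent_silent by auto
      then have "b \<in> outputs I - urgent I"
        using step_carrier[OF step(1)] no_inputs urgent_silent by auto
      then show ?thesis using step_generative[OF step(1)] step by blast
    qed
    obtain x b C' s' where x: "step I s {x} b C' s'" "v x \<le> 0" "\<mu> = jump I v C' s'"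
      using *[OF \<mu>] by blast
    obtain x' b' D' t' where x': "step I s {x'} b' D' t'" "v x' \<le> 0" "\<mu>' = jump I v D' t'"
      using *[OF \<mu>'] by blast
    have "x = x'"
      using zero[OF x(1,2)] zero[OF x'(1,2)] rf by (auto simp: race_free_def inj_on_def)
    then show ?thesis using clock_deterministic[of s x] x x' by blast
  qed
  have unstable: "is_stable I s" if a: "a \<in> outputs I - urgent I" and \<mu>: "\<mu> \<in> nlmp I (Act a) z"
    for a \<mu>
  proof -
    from \<mu> obtain C C' s' where step: "step I s C a C' s'" "\<forall>x\<in>C. v x \<le> 0"
      by (auto simp: zv)
    then obtain x where "step I s {x} a C' s'" "v x \<le> 0"
      using step_generative[OF step(1) a] by auto
    then have "x \<in> active s" "v x = 0" using zero by blast+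
    then show ?thesis using rf by (auto simp: race_free_def)
  qed
  have location: "stable_location I (fst z) \<longleftrightarrow> is_stable I s"
    by (simp add: zv stable_location_def)
  have init: "nlmp I Init z = {}"
    by (simp add: zv)
  have act: "\<exists>a. \<nu> \<in> nlmp I (Act a) z"
    if "\<nu> \<in> (\<Union>l \<in> insert Init (Act ` (inputs I \<union> outputs I)). nlmp I l z)" for \<nu>
    using that init by auto
  have weak: "\<mu> = \<mu>'" if "weak I z \<mu>" "weak I z \<mu>'" for \<mu> \<mu>'
    using that weak_unique unfolding zv by metis
  show ?thesis
  proof
    assume "nondeterministic_state I z"
    then consider \<mu> \<mu>' where "is_stable I s" "\<mu> \<noteq> \<mu>'"
        "{\<mu>, \<mu>'} \<subseteq> (\<Union>l \<in> insert Init (Act ` (inputs I \<union> outputs I)). nlmp I l z)"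
      | \<mu> \<mu>' where "weak I z \<mu>" "weak I z \<mu>'" "\<mu> \<noteq> \<mu>'"
      | a \<mu> where "\<not> is_stable I s" "a \<in> outputs I - urgent I" "\<mu> \<in> nlmp I (Act a) z"
      unfolding nondeterministic_state_def location by metis
    then show False
    proof cases
      case (1 \<mu> \<mu>')
      then obtain a a' where "\<mu> \<in> nlmp I (Act a) z" "\<mu>' \<in> nlmp I (Act a') z"
        using act[of \<mu>] act[of \<mu>'] by auto
      then show ?thesis using stable[OF 1(1)] 1(2) by metis
    next
      case 2
      then show ?thesis using weak by metis
    next
      case 3
      then show ?thesis using unstable by metis
    qed
  qed
qed

lemma never_nondeterministic:
  "almost_never_reached I {z \<in> space (state_space I). nondeterministic_state I z}"
proof -
  obtain active where active:
    "\<And>s. s \<in> states I \<Longrightarrow> active s \<subseteq> clocks I" "active (start I) \<subseteq> start_clocks I"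
    "\<And>s. s \<in> states I \<Longrightarrow> enabling I s \<subseteq> active s"
    "\<And>s. s \<in> states I \<Longrightarrow> is_stable I s \<Longrightarrow> active s = enabling I s"
    "\<And>t C a C' s. step I t C a C' s \<Longrightarrow> active s \<subseteq> (active t - C) \<union> C'"
    using active_clocks by metis
  show ?thesis
  proof (rule almost_never_reachedI[OF sets_good_states[of active, OF active(1)]])
    show "{z \<in> space (state_space I). nondeterministic_state I z} \<inter> good_states active = {}"
      using good_state_not_nondeterministic[OF _ active(3)] by blast
    show "(None, v) \<in> good_states active" if "v \<in> space (valuations I)" for v
      using that by (simp add: good_states_def state_space_def space_pair_measure locations_def)
    fix z l \<mu> assume z: "z \<in> good_states active" and \<mu>: "\<mu> \<in> nlmp I l z"
    obtain q v where zv: "z = (q, v)" by force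
    show "AE z' in \<mu>. z' \<in> good_states active"
    proof (cases q)
      case None
      then have "\<mu> = jump I v (clocks I) (start I)"
        using \<mu> by (cases l) (auto simp: zv)
      \<comment> \<open>The initial jump resamples all clocks, so this set is empty.\<close>
      moreover have "race_free strict (active (start I) - clocks I) v" for strict
        using active(1)[OF start] by (auto simp: race_free_def inj_on_def)
      ultimately show ?thesis
        using start active(1) by (auto intro!: AE_jump_good_states)
    next
      case (Some s)
      have s: "s \<in> states I" and rf: "race_free (\<not> is_stable I s) (active s) v"
        using z unfolding zv good_states_def
        by (auto simp: Some state_space_def space_pair_measure locations_def)
      show ?thesis
      proof (cases l)
        case (Act a)
        then obtain C C' s' where step: "step I s C a C' s'" "\<forall>x\<in>C. v x \<le> 0"
          and \<mu>: "\<mu> = jump I v C' s'"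
          using \<mu> by (auto simp: zv Some)
        have "race_free True (active s - C) v"
          by (rule race_free_step[OF rf active(3)[OF s] step])
        \<comment> \<open>A clock active after the step is either resampled or was active before and
          not consumed, so strictness carries over to it.\<close>
        moreover have "active s' - C' \<subseteq> active s - C"
          using active(5)[OF step(1)] by blast
        ultimately have "race_free (\<not> is_stable I s') (active s' - C') v"
          unfolding race_free_def by (meson inj_on_subset subsetD)
        then show ?thesis
          unfolding \<mu> using step_carrier[OF step(1)] active(1) by (intro AE_jump_good_states) auto
      next
        case (Delay d)
        have no_urgent: "\<not> (\<exists>b\<in>urgent I \<inter> outputs I. \<exists>C C' s'. step I s C b C' s')"
          and d: "ereal d \<le> (INF x \<in> {x. \<exists>a\<in>outputs I. \<exists>C' s'. step I s {x} a C' s'}. ereal (v x))"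
          and \<mu>: "\<mu> = jump I (\<lambda>x. v x - d) {} s"
          using \<mu> by (auto simp: zv Some Delay split: if_splits)
        have st: "is_stable I s" using no_urgent by (auto simp: is_stable_def)
        \<comment> \<open>In a stable state active clocks are enabled, so the bound on the delay
          covers all of them.\<close>
        have "d \<le> v x" if x: "x \<in> active s" for x
        proof -
          obtain a C' s' where step: "step I s {x} a C' s'"
            using x active(4)[OF s st] unfolding enabling_def by blast
          then have "a \<in> outputs I" using step_carrier[OF step] no_inputs by auto
          then have "ereal d \<le> ereal (v x)"
            using d step by (intro order_trans[OF d INF_lower]) auto
          then show ?thesis by simp
        qed
        \<comment> \<open>A common shift keeps values distinct. A clock may reach zero, which is
          allowed because \<open>s\<close> is stable.\<close>
        then have "race_free (\<not> is_stable I s) (active s - {}) (\<lambda>x. v x - d)"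
          using rf st by (auto simp: race_free_def inj_on_def)
        then show ?thesis
          unfolding \<mu> using s active(1) by (intro AE_jump_good_states) auto
      next
        case Init
        then show ?thesis using \<mu> by (simp add: zv Some)
      qed
    qed
  qed
qed

end

section \<open>Passing to the renamed automaton\<close>

lemma confluent_rename_urgent:
  assumes "IOSA I" "confluent I"
  shows "confluent (rename_urgent I)"
  unfolding confluent_def confluent_wrt_def
proof (intro ballI allI impI)
  interpret IOSA I by fact
  fix a b s C1 s1 C2 s2
  assume ab: "a \<in> urgent (rename_urgent I)" "b \<in> urgent (rename_urgent I)"
    and steps: "step (rename_urgent I) s {} a C1 s1" "step (rename_urgent I) s {} b C2 s2"
    and neq: "(a, C1, s1) \<noteq> (b, C2, s2)"
  have silent: "a = silent I" "b = silent I"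
    using ab by (auto simp: rename_urgent_def)
  have urgent_step: "step (rename_urgent I) t {} (silent I) C t' \<longleftrightarrow>
      (\<exists>c\<in>urgent I. step I t {} c C t')" for t C t'
    using silent_action by (auto simp: rename_urgent_def)
  obtain c d where c: "c \<in> urgent I" "step I s {} c C1 s1"
    and d: "d \<in> urgent I" "step I s {} d C2 s2"
    using steps unfolding silent urgent_step by blast
  \<comment> \<open>The renamed labels are equal, so the transitions differ in clocks or target, and
    the original ones differ as well, whatever \<open>c\<close> and \<open>d\<close> are.\<close>
  moreover have "(c, C1, s1) \<noteq> (d, C2, s2)"
    using neq silent by auto
  ultimately obtain s3 where "step I s1 {} d C2 s3" "step I s2 {} c C1 s3"
    using assms(2) unfolding confluent_def confluent_wrt_def by blast
  then show "\<exists>s3. step (rename_urgent I) s1 {} b C2 s3 \<and> step (rename_urgent I) s2 {} a C1 s3"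
    unfolding silent urgent_step using c(1) d(1) by blast
qed

theorem theorem3:
  fixes I :: "('s, 'a, 'c) iosa"
  assumes "IOSA I"
    and "closed_iosa I"
    and "confluent I"
  shows "weakly_deterministic I"
proof -
  interpret J: confluent_silent_iosa "rename_urgent I"
  proof (rule confluent_silent_iosa.intro)
    show "IOSA (rename_urgent I)"
      by (rule IOSA_rename_urgent[OF assms(1,2)])
    show "confluent_silent_iosa_axioms (rename_urgent I)"
      using assms(2) confluent_rename_urgent[OF assms(1,3)]
      by unfold_locales (simp_all add: rename_urgent_def closed_iosa_def)
  qed
  show ?thesis
    unfolding weakly_deterministic_def
    using J.weak_well_defined J.never_nondeterministic by blast
qed

end
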